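(* Let $(X,d)$ be a metric space, $Y$ a real vector space, $K\subset Y$ a convex cone and $k_0\in K\setminus-\mathrm{vcl}(K)$. Let $f:X\to 2^Y$ be $K$-slm and have $K$-$v_0$-closed values, where $v_0\in k_0+K$. Suppose that $\epsilon>0$ and $x_0\in X$ are such that $f(x_0)\not\subset f(X)+\epsilon k_0+K$, let $\lambda>0$ be a constant, and for $x\in X$ put $S(x)=\{x'\in X: f(x)\subset f(x')+(\epsilon/\lambda)d(x,x')k_0+K\}$. Suppose that $(X,d)$ is $S(x_0)$-dynamically complete (or, $(X,d)$ is $(f,K)$-lower complete). Then there exists $\bar x\in X$ such that (a) $f(x_0)\subset f(\bar x)+(\epsilon/\lambda)d(x_0,\bar x)k_0+K$; (b) $\bar x$ is a strict minimizer of the map $x\mapsto f(x)+(\epsilon/\lambda)d(\bar x,x)k_0$, i.e., $f(\bar x)\not\subset f(x)+(\epsilon/\lambda)d(\bar x,x)k_0+K$ for all $x\in X\setminus\{\bar x\}$; (c) $d(x_0,\bar x)\le\lambda$.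
   Context: $2^Y$ is the family of all subsets of $Y$; for $A\subset X$, $f(A)=\bigcup_{x\in A}f(x)$. For $A,B\subset Y$, $A+B=\{a+b:a\in A,b\in B\}$, and a vector $y$ added to a set means $\{y\}$. A cone is a nonempty set $K\subset Y$ with $\alpha K\subset K$ for all $\alpha\ge 0$; it is a convex cone if also $K+K\subset K$. Cones are always assumed nontrivial: $K\ne\{0\}$ and $K\ne Y$. For nonempty $A\subset Y$, the vector closure is $\mathrm{vcl}(A)=\{y\in Y:\exists v\in Y,\ \exists \lambda_n\ge 0,\ \lambda_n\to 0 \text{ with } y+\lambda_n v\in A\ \forall n\in\mathbb N\}$; for $v_0\in Y$, $\mathrm{vcl}_{v_0}(A)=\{y\in Y:\exists\lambda_n\ge 0,\ \lambda_n\to 0\text{ with }y+\lambda_n v_0\in A\ \forall n\in\mathbb N\}$, and $A$ is $v_0$-closed if $A=\mathrm{vcl}_{v_0}(A)$. $(X,d)$ is $S(x)$-dynamically complete if for any Cauchy sequence $(x_n)\subset S(x)$ with $x_{n+1}\in S(x_n)$ for all $n$, there exists $\bar x\in X$ with $x_n\to\bar x$. $(X,d)$ is $(f,K)$-lower complete if every Cauchy sequence $(x_n)\subset X$ with $f(x_n)\subset f(x_{n+1})+K$ for all $n$ converges to some point of $X$. $f$ is $K$-slm ($K$-sequentially lower monotone) if for any sequence $(x_n)\subset X$ with $x_n\to\bar x\in X$ and $f(x_n)\subset f(x_{n+1})+K$ for all $n$, one has $f(x_n)\subset f(\bar x)+K$ for all $n$. $f$ has $K$-$v_0$-closed values if $f(x)+K$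 is $v_0$-closed for all $x\in X$. *)

theory Defs
  imports "HOL-Analysis.Analysis" "HOL-Library.Set_Algebras"
begin

(* A + B on sets is the Minkowski sum of Set_Algebras.  Set-valued maps may take the
   value {}, and A + {} = {}. *)

definition vcl :: "'y::real_vector set \<Rightarrow> 'y set" where
  "vcl A = {y. \<exists>v. \<exists>l :: nat \<Rightarrow> real.
      (\<forall>n. l n \<ge> 0) \<and> l \<longlonglongrightarrow> 0 \<and> (\<forall>n. y + l n *\<^sub>R v \<in> A)}"

definition vcl_dir :: "'y::real_vector \<Rightarrow> 'y set \<Rightarrow> 'y set" where
  "vcl_dir v\<^sub>0 A = {y. \<exists>l :: nat \<Rightarrow> real.
      (\<forall>n. l n \<ge> 0) \<and> l \<longlonglongrightarrow> 0 \<and> (\<forall>n. y + l n *\<^sub>R v\<^sub>0 \<in> A)}"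

definition dir_closed :: "'y::real_vector \<Rightarrow> 'y set \<Rightarrow> bool" where
  "dir_closed v\<^sub>0 A \<longleftrightarrow> A = vcl_dir v\<^sub>0 A"

(* Library convex_cone only says nonempty, convex and closed under nonnegative scaling
   (for such sets convexity is the same as K + K \<subseteq> K, see convex_cone_iff);
   it admits {0} and the whole space. *)
definition nontrivial_convex_cone :: "'y::real_vector set \<Rightarrow> bool" where
  "nontrivial_convex_cone K \<longleftrightarrow> convex_cone K \<and> K \<noteq> {0} \<and> K \<noteq> UNIV"

definition dynamically_complete ::
    "('x::metric_space \<Rightarrow> 'x set) \<Rightarrow> 'x \<Rightarrow> bool" where
  "dynamically_complete S x \<longleftrightarrow>
     (\<forall>u :: nat \<Rightarrow> 'x. Cauchy u \<and> (\<forall>n. u n \<in> S x) \<and> (\<forall>n. u (Suc n) \<in> S (u n))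
        \<longrightarrow> (\<exists>xbar. u \<longlonglongrightarrow> xbar))"

definition lower_complete ::
    "('x::metric_space \<Rightarrow> 'y::real_vector set) \<Rightarrow> 'y set \<Rightarrow> bool" where
  "lower_complete f K \<longleftrightarrow>
     (\<forall>u :: nat \<Rightarrow> 'x. Cauchy u \<and> (\<forall>n. f (u n) \<subseteq> f (u (Suc n)) + K)
        \<longrightarrow> (\<exists>xbar. u \<longlonglongrightarrow> xbar))"

definition seq_lower_monotone ::
    "'y::real_vector set \<Rightarrow> ('x::metric_space \<Rightarrow> 'y set) \<Rightarrow> bool" where
  "seq_lower_monotone K f \<longleftrightarrow>
     (\<forall>(u :: nat \<Rightarrow> 'x) xbar. u \<longlonglongrightarrow> xbar \<and> (\<forall>n. f (u n) \<subseteq> f (u (Suc n)) + K)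
        \<longrightarrow> (\<forall>n. f (u n) \<subseteq> f xbar + K))"

definition has_dir_closed_values ::
    "'y::real_vector set \<Rightarrow> 'y \<Rightarrow> ('x \<Rightarrow> 'y set) \<Rightarrow> bool" where
  "has_dir_closed_values K v\<^sub>0 f \<longleftrightarrow> (\<forall>x. dir_closed v\<^sub>0 (f x + K))"

end

theory Submission
  imports Defs
begin

text \<open>
  This is Ekeland's variational principle for a set-valued map. Write \<open>c = \<epsilon> / lam\<close>. The relation
  \<open>x' \<in> S x\<close>, which says that passing from \<open>x\<close> to \<open>x'\<close> lowers \<open>f\<close> by at least
  \<open>c \<cdot> dist x x'\<close> in the direction \<open>k\<^sub>0\<close>, is reflexive and transitive, and a point \<open>xbar\<close>
  satisfies (a) and (b) exactly when \<open>xbar \<in> S x\<^sub>0\<close> and \<open>S xbar = {xbar}\<close>. Such a point is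
  found as the limit of a greedy sequence in which every step covers at least half of the distance
  still available (lemma \<open>exists_terminal_point\<close>).

  The order-theoretic argument needs every sequence \<open>u (n + 1) \<in> S (u n)\<close> starting in \<open>x\<^sub>0\<close> to
  converge to a point of all the sets \<open>S (u n)\<close>.
  The gains along such a sequence add up, and \<open>x\<^sub>0\<close> being an \<open>\<epsilon>\<close>-minimizer caps every total gain
  at \<open>\<epsilon>\<close> (lemma \<open>gain_less_if_approx_minimal\<close>). Hence the sequence has length at most \<open>lam\<close>, so
  it is Cauchy and either kind of completeness yields a limit; the same cap, applied to a single
  step, gives (c). Sequential lower monotonicity compares the values along the sequence with the
  value at the limit, and since the gains depend continuously on the points, closedness of
  \<open>f xbar + K\<close> in the direction \<open>v\<^sub>0\<close> upgrades this comparison to \<open>xbar \<in> S (u n)\<close>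
  (lemma \<open>gain_limit\<close>).
\<close>

section \<open>Terminal points of a preorder on a metric space\<close>

lemma Cauchy_if_bounded_length:
  fixes u :: "nat \<Rightarrow> 'x::metric_space"
  assumes bound: "\<And>n. (\<Sum>i<n. dist (u i) (u (Suc i))) \<le> B"
  shows "Cauchy u"
proof -
  define s where "s n = (\<Sum>i<n. dist (u i) (u (Suc i)))" for n
  have "summable (\<lambda>i. dist (u i) (u (Suc i)))"
    by (rule summableI_nonneg_bounded[OF _ bound]) simp
  then have "Cauchy s"
    unfolding s_def by (simp add: summable_iff_convergent convergent_Cauchy)
  have "dist (u m) (u (m + k)) \<le> s (m + k) - s m" for m k
  proof (induction k)
    case (Suc k)
    have "dist (u m) (u (m + Suc k)) \<le> dist (u m) (u (m + k)) + dist (u (m + k)) (u (Suc (m + k)))"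
      by (simp add: dist_triangle)
    with Suc show ?case by (simp add: s_def)
  qed simp
  then have step: "dist (u n) (u N) \<le> dist (s n) (s N)" if "N \<le> n" for n N
    using that by (metis abs_ge_self dist_commute dist_real_def le_Suc_ex order_trans)
  show ?thesis
    unfolding Cauchy_altdef2
  proof (intro allI impI)
    fix e :: real assume "e > 0"
    with \<open>Cauchy s\<close> obtain N where "\<forall>n\<ge>N. dist (s n) (s N) < e"
      unfolding Cauchy_altdef2 by blast
    then show "\<exists>N. \<forall>n\<ge>N. dist (u n) (u N) < e"
      using step by (meson le_less_trans)
  qed
qed

lemma exists_half_farthest:
  fixes A :: "'x::metric_space set"
  assumes "bounded A" and "x \<in> A"
  shows "\<exists>y\<in>A. \<forall>z\<in>A. dist x z \<le> 2 * dist x y"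
proof -
  obtain b where b: "\<forall>z\<in>A. dist x z \<le> b"
    using \<open>bounded A\<close> bounded_any_center by blast
  then have bdd: "bdd_above (dist x ` A)" by (auto intro: bdd_aboveI)
  define s where "s = (SUP z\<in>A. dist x z)"
  have upper: "dist x z \<le> s" if "z \<in> A" for z
    unfolding s_def by (rule cSUP_upper[OF that bdd])
  show ?thesis
  proof (cases "s > 0")
    case True
    then have "s / 2 < (SUP z\<in>A. dist x z)" by (simp add: s_def)
    then obtain y where "y \<in> A" "s / 2 < dist x y"
      using less_cSUP_iff[OF _ bdd] \<open>x \<in> A\<close> by blast
    then show ?thesis using upper by (force intro!: bexI[of _ y])
  next
    case False
    then have "dist x z \<le> 0" if "z \<in> A" for z using upper[OF that] by linarith
    then have "\<forall>z\<in>A. dist x z \<le> 2 * dist x x" by simp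
    then show ?thesis using \<open>x \<in> A\<close> by blast
  qed
qed

text \<open>
  A variant of the Dancs-Hegedus-Medvegyev theorem. In the greedy sequence the radius of
  \<open>S (u n)\<close> around \<open>u n\<close> is at most twice the next step; the steps of a convergent sequence
  vanish, so at most one point lies in all the \<open>S (u n)\<close>.
  The limit is such a point, and by transitivity so is every element of \<open>S\<close> of the limit.
\<close>

lemma exists_terminal_point:
  fixes S :: "'x::metric_space \<Rightarrow> 'x set"
  assumes refl: "\<And>x. x \<in> S x"
    and trans: "\<And>x y z. y \<in> S x \<Longrightarrow> z \<in> S y \<Longrightarrow> z \<in> S x"
    and bounded: "bounded (S x\<^sub>0)"
    and limit: "\<And>u. u 0 = x\<^sub>0 \<Longrightarrow> (\<And>n. u (Suc n) \<in> S (u n)) \<Longrightarrow>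
      \<exists>xbar. u \<longlonglongrightarrow> xbar \<and> (\<forall>n. xbar \<in> S (u n))"
  shows "\<exists>xbar \<in> S x\<^sub>0. S xbar = {xbar}"
proof -
  have "\<exists>u. \<forall>n. (u n \<in> S x\<^sub>0 \<and> (n = 0 \<longrightarrow> u n = x\<^sub>0)) \<and>
      (u (Suc n) \<in> S (u n) \<and> (\<forall>z\<in>S (u n). dist (u n) z \<le> 2 * dist (u n) (u (Suc n))))"
  proof (rule dependent_nat_choice)
    fix x and n :: nat assume x: "x \<in> S x\<^sub>0 \<and> (n = 0 \<longrightarrow> x = x\<^sub>0)"
    then have "bounded (S x)" using trans by (blast intro: bounded_subset[OF bounded])
    then obtain y where "y \<in> S x" "\<forall>z\<in>S x. dist x z \<le> 2 * dist x y"
      using exists_half_farthest refl by blast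
    then show "\<exists>y. (y \<in> S x\<^sub>0 \<and> (Suc n = 0 \<longrightarrow> y = x\<^sub>0)) \<and>
        (y \<in> S x \<and> (\<forall>z\<in>S x. dist x z \<le> 2 * dist x y))"
      using x trans by blast
  qed (use refl in blast)
  then obtain u where u0: "u 0 = x\<^sub>0" and chain: "\<And>n. u (Suc n) \<in> S (u n)"
    and greedy: "\<And>n z. z \<in> S (u n) \<Longrightarrow> dist (u n) z \<le> 2 * dist (u n) (u (Suc n))"
    by blast
  obtain xbar where lim: "u \<longlonglongrightarrow> xbar" and below: "\<And>n. xbar \<in> S (u n)"
    using limit[OF u0 chain] by blast
  have "z = xbar" if "z \<in> S xbar" for z
  proof -
    have "(\<lambda>n. 2 * dist (u n) (u (Suc n))) \<longlonglongrightarrow> 2 * dist xbar xbar"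
      by (intro tendsto_intros lim LIMSEQ_Suc)
    then have "(\<lambda>n. dist (u n) z) \<longlonglongrightarrow> 0"
      using greedy[OF trans[OF below that]]
      by (intro tendsto_sandwich[of "\<lambda>_. 0" "\<lambda>n. dist (u n) z" _
            "\<lambda>n. 2 * dist (u n) (u (Suc n))"]) auto
    then show ?thesis
      using LIMSEQ_unique lim tendsto_dist_iff by blast
  qed
  then show ?thesis using below[of 0] u0 refl by blast
qed

section \<open>Gains of set values along a direction\<close>

text \<open>
  For \<open>A = {a}\<close> and \<open>B = {b}\<close> this is \<open>b + t k \<le> a\<close> in the order of the cone \<open>K\<close>, so \<open>t\<close> is
  an amount by which \<open>B\<close> improves on \<open>A\<close>; the case \<open>t = 0\<close> is the lower set-less relation.
\<close>

definition gain :: "'y::real_vector set \<Rightarrow> 'y \<Rightarrow> real \<Rightarrow> 'y set \<Rightarrow> 'y set \<Rightarrow> bool" where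
  "gain K k t A B \<longleftrightarrow> A \<subseteq> B + {t *\<^sub>R k} + K"

lemma gain_iff: "gain K k t A B \<longleftrightarrow> (\<forall>a\<in>A. \<exists>b\<in>B. a - b - t *\<^sub>R k \<in> K)"
proof -
  have "a \<in> B + {t *\<^sub>R k} + K \<longleftrightarrow> (\<exists>b\<in>B. a - b - t *\<^sub>R k \<in> K)" for a
  proof
    assume "a \<in> B + {t *\<^sub>R k} + K"
    then obtain b y where "b \<in> B" "y \<in> K" "a = b + t *\<^sub>R k + y"
      by (auto simp: set_plus_def)
    then show "\<exists>b\<in>B. a - b - t *\<^sub>R k \<in> K"
      by (intro bexI[of _ b]) auto
  next
    assume "\<exists>b\<in>B. a - b - t *\<^sub>R k \<in> K"
    then obtain b where "b \<in> B" "a - b - t *\<^sub>R k \<in> K" by blast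
    then have "(b + t *\<^sub>R k) + (a - b - t *\<^sub>R k) \<in> B + {t *\<^sub>R k} + K" by blast
    then show "a \<in> B + {t *\<^sub>R k} + K" by simp
  qed
  then show ?thesis by (auto simp: gain_def)
qed

lemma gain_0_iff: "gain K k 0 A B \<longleftrightarrow> A \<subseteq> B + K"
  by (simp add: gain_def flip: set_zero)

lemma gain_refl: "convex_cone K \<Longrightarrow> gain K k 0 A A"
  unfolding gain_iff by (auto intro!: bexI simp: convex_cone_contains_0)

text \<open>Surplus gain \<open>s + t - r\<close> is absorbed by the cone because \<open>k\<close> lies in it.\<close>

lemma gain_trans:
  assumes "convex_cone K" and "k \<in> K"
    and AB: "gain K k s A B" and BC: "gain K k t B C" and "r \<le> s + t"
  shows "gain K k r A C"
  unfolding gain_iff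
proof
  fix a assume "a \<in> A"
  with AB obtain b where "b \<in> B" and b: "a - b - s *\<^sub>R k \<in> K" unfolding gain_iff by blast
  with BC obtain c where "c \<in> C" and c: "b - c - t *\<^sub>R k \<in> K" unfolding gain_iff by blast
  have "(s + t - r) *\<^sub>R k \<in> K"
    using assms by (simp add: convex_cone_scaleR)
  with b c have "(a - b - s *\<^sub>R k) + (b - c - t *\<^sub>R k) + (s + t - r) *\<^sub>R k \<in> K"
    by (intro convex_cone_add[OF \<open>convex_cone K\<close>])
  then have "a - c - r *\<^sub>R k \<in> K" by (simp add: algebra_simps)
  with \<open>c \<in> C\<close> show "\<exists>c\<in>C. a - c - r *\<^sub>R k \<in> K" by blast
qed

lemma gain_mono:
  assumes "convex_cone K" and "k \<in> K" and "gain K k s A B" and "r \<le> s"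
  shows "gain K k r A B"
  using gain_trans[OF assms(1-3) gain_refl[OF assms(1)]] assms(4) by simp

lemma gain_sum:
  assumes "convex_cone K" and "k \<in> K" and "\<And>n. gain K k (t n) (F n) (F (Suc n))"
  shows "gain K k (\<Sum>i<n. t i) (F 0) (F n)"
proof (induction n)
  case 0
  show ?case using assms(1) by (simp add: gain_refl)
next
  case (Suc n)
  show ?case by (rule gain_trans[OF assms(1,2) Suc assms(3)]) simp
qed

lemma gain_less_if_approx_minimal:
  assumes "convex_cone K" and "k \<in> K"
    and minimal: "\<not> A \<subseteq> (\<Union>x. f x) + {e *\<^sub>R k} + K"
    and "gain K k t A (f x)"
  shows "t < e"
proof (rule ccontr)
  assume "\<not> t < e"
  then have "gain K k e A (f x)"
    using gain_mono[OF assms(1,2,4)] by simp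
  then have "gain K k e A (\<Union>x. f x)" unfolding gain_iff by blast
  with minimal show False by (simp add: gain_def)
qed

text \<open>
  If \<open>a\<close> exceeds \<open>B\<close> by \<open>t n\<close> for every \<open>n\<close>, then moving \<open>a - \<tau> k\<close> by \<open>\<bar>\<tau> - t n\<bar>\<close> along
  \<open>k\<close> puts it into \<open>B + K\<close>, and moving it further along \<open>K\<close> keeps it there. So
  \<open>v \<in> k + K\<close> is also a direction of approach, and closedness along \<open>v\<close> applies.
\<close>

lemma gain_limit:
  assumes cone: "convex_cone K" and "k \<in> K" and v: "v \<in> {k} + K"
    and closed: "dir_closed v (B + K)"
    and gain: "\<And>n. gain K k (t n) A B" and lim: "t \<longlonglongrightarrow> \<tau>"
  shows "gain K k \<tau> A B"
  unfolding gain_iff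
proof
  fix a assume "a \<in> A"
  define l where "l n = \<bar>\<tau> - t n\<bar>" for n
  obtain w where "w \<in> K" and w: "v = k + w" using v by (auto simp: set_plus_def)
  have "(\<lambda>n. \<bar>\<tau> - t n\<bar>) \<longlonglongrightarrow> \<bar>\<tau> - \<tau>\<bar>" by (intro tendsto_intros lim)
  then have "l \<longlonglongrightarrow> 0" by (simp add: l_def[abs_def])
  moreover have "(a - \<tau> *\<^sub>R k) + l n *\<^sub>R v \<in> B + K" for n
  proof -
    obtain b where "b \<in> B" and b: "a - b - t n *\<^sub>R k \<in> K"
      using gain[of n] \<open>a \<in> A\<close> unfolding gain_iff by blast
    have "(l n + t n - \<tau>) *\<^sub>R k \<in> K" and "l n *\<^sub>R w \<in> K"
      using cone \<open>k \<in> K\<close> \<open>w \<in> K\<close> by (auto simp: l_def intro!: convex_cone_scaleR)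
    with b have "(a - b - t n *\<^sub>R k) + (l n + t n - \<tau>) *\<^sub>R k + l n *\<^sub>R w \<in> K"
      by (intro convex_cone_add[OF cone])
    with \<open>b \<in> B\<close> have "b + ((a - b - t n *\<^sub>R k) + (l n + t n - \<tau>) *\<^sub>R k + l n *\<^sub>R w) \<in> B + K"
      by blast
    then show ?thesis by (simp add: w algebra_simps)
  qed
  ultimately have "a - \<tau> *\<^sub>R k \<in> vcl_dir v (B + K)"
    unfolding vcl_dir_def by (auto simp: l_def intro!: exI[of _ l])
  then have "a - \<tau> *\<^sub>R k \<in> B + K" using closed by (simp add: dir_closed_def)
  then obtain b y where "b \<in> B" "y \<in> K" "a - \<tau> *\<^sub>R k = b + y" by (auto elim: set_plus_elim)
  then have "a - b - \<tau> *\<^sub>R k = y" by (simp add: algebra_simps)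
  with \<open>b \<in> B\<close> \<open>y \<in> K\<close> show "\<exists>b\<in>B. a - b - \<tau> *\<^sub>R k \<in> K" by auto
qed

section \<open>Ekeland's principle\<close>

theorem corollary5p8:
  fixes f :: "'x::metric_space \<Rightarrow> 'y::real_vector set"
    and S :: "'x \<Rightarrow> 'x set"
    and K :: "'y set" and k\<^sub>0 v\<^sub>0 :: 'y
    and \<epsilon> lam :: real and x\<^sub>0 :: 'x
  assumes K: "nontrivial_convex_cone K"
    and k0: "k\<^sub>0 \<in> K - uminus ` vcl K"
    and slm: "seq_lower_monotone K f"
    and v0: "v\<^sub>0 \<in> {k\<^sub>0} + K"
    and closed_values: "has_dir_closed_values K v\<^sub>0 f"
    and eps: "\<epsilon> > 0"
    and x0: "\<not> f x\<^sub>0 \<subseteq> (\<Union>x. f x) + {\<epsilon> *\<^sub>R k\<^sub>0} + K"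
    and lam_pos: "lam > 0"
    and S: "\<And>x. S x = {x'. f x \<subseteq> f x' + {(\<epsilon> / lam * dist x x') *\<^sub>R k\<^sub>0} + K}"
    and complete: "dynamically_complete S x\<^sub>0 \<or> lower_complete f K"
  shows "\<exists>xbar.
      f x\<^sub>0 \<subseteq> f xbar + {(\<epsilon> / lam * dist x\<^sub>0 xbar) *\<^sub>R k\<^sub>0} + K \<and>
      (\<forall>x. x \<noteq> xbar \<longrightarrow> \<not> f xbar \<subseteq> f x + {(\<epsilon> / lam * dist xbar x) *\<^sub>R k\<^sub>0} + K) \<and>
      dist x\<^sub>0 xbar \<le> lam"
proof -
  have cone: "convex_cone K" using K by (simp add: nontrivial_convex_cone_def)
  have "k\<^sub>0 \<in> K" using k0 by blast
  define c where "c = \<epsilon> / lam"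
  have "c > 0" using eps lam_pos by (simp add: c_def)
  have S_iff: "x' \<in> S x \<longleftrightarrow> gain K k\<^sub>0 (c * dist x x') (f x) (f x')" for x x'
    by (simp add: S gain_def c_def)
  have cap: "t < lam" if "gain K k\<^sub>0 (c * t) (f x\<^sub>0) (f x)" for t x
  proof -
    have "c * t < \<epsilon>"
      using gain_less_if_approx_minimal[OF cone \<open>k\<^sub>0 \<in> K\<close> x0 that] .
    then show ?thesis using eps lam_pos by (simp add: c_def field_simps)
  qed
  have refl: "x \<in> S x" for x
    by (simp add: S_iff gain_refl[OF cone])
  have trans: "z \<in> S x" if "y \<in> S x" "z \<in> S y" for x y z
  proof -
    have "c * dist x z \<le> c * dist x y + c * dist y z"
      using \<open>c > 0\<close> by (simp add: dist_triangle flip: distrib_left)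
    then show ?thesis
      using gain_trans[OF cone \<open>k\<^sub>0 \<in> K\<close>] that unfolding S_iff by blast
  qed
  have near: "dist x\<^sub>0 x < lam" if "x \<in> S x\<^sub>0" for x
    using cap that unfolding S_iff .
  have bounded: "bounded (S x\<^sub>0)"
    unfolding bounded_any_center[where a = x\<^sub>0] using near by (auto intro: less_imp_le)
  have limit: "\<exists>xbar. u \<longlonglongrightarrow> xbar \<and> (\<forall>n. xbar \<in> S (u n))"
    if u0: "u 0 = x\<^sub>0" and chain: "\<And>n. u (Suc n) \<in> S (u n)" for u
  proof -
    have tail: "u (n + m) \<in> S (u n)" for n m
    proof (induction m)
      case 0
      show ?case by (simp add: refl)
    next
      case (Suc m)
      show ?case using trans[OF Suc chain] by simp
    qed
    have lower: "f (u n) \<subseteq> f (u (Suc n)) + K" for n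
    proof -
      have "gain K k\<^sub>0 0 (f (u n)) (f (u (Suc n)))"
        using gain_mono[OF cone \<open>k\<^sub>0 \<in> K\<close>] chain[of n] \<open>c > 0\<close> by (fastforce simp: S_iff)
      then show ?thesis by (simp add: gain_0_iff)
    qed
    have "(\<Sum>i<n. dist (u i) (u (Suc i))) \<le> lam" for n
    proof -
      have "gain K k\<^sub>0 (\<Sum>i<n. c * dist (u i) (u (Suc i))) (f (u 0)) (f (u n))"
        using chain by (intro gain_sum[OF cone \<open>k\<^sub>0 \<in> K\<close>]) (simp add: S_iff)
      then show ?thesis
        using cap u0 by (fastforce simp flip: sum_distrib_left)
    qed
    then have "Cauchy u" by (rule Cauchy_if_bounded_length)
    have "\<exists>xbar. u \<longlonglongrightarrow> xbar"
      using complete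
    proof
      assume "dynamically_complete S x\<^sub>0"
      moreover have "u n \<in> S x\<^sub>0" for n using tail[of 0 n] u0 by simp
      ultimately show ?thesis
        using \<open>Cauchy u\<close> chain unfolding dynamically_complete_def by blast
    next
      assume "lower_complete f K"
      then show ?thesis
        using \<open>Cauchy u\<close> lower unfolding lower_complete_def by blast
    qed
    then obtain xbar where lim: "u \<longlonglongrightarrow> xbar" by blast
    have at_limit: "gain K k\<^sub>0 0 (f (u n)) (f xbar)" for n
      using slm lim lower unfolding seq_lower_monotone_def gain_0_iff by blast
    have "gain K k\<^sub>0 (c * dist (u n) xbar) (f (u n)) (f xbar)" for n
    proof (rule gain_limit[OF cone \<open>k\<^sub>0 \<in> K\<close> v0])
      show "dir_closed v\<^sub>0 (f xbar + K)"
        using closed_values by (simp add: has_dir_closed_values_def)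
      show "gain K k\<^sub>0 (c * dist (u n) (u (n + m))) (f (u n)) (f xbar)" for m
        using gain_trans[OF cone \<open>k\<^sub>0 \<in> K\<close> tail[of n m, unfolded S_iff] at_limit] by simp
      have "(\<lambda>m. u (n + m)) \<longlonglongrightarrow> xbar"
        using LIMSEQ_ignore_initial_segment[OF lim, of n] by (simp add: add.commute)
      then show "(\<lambda>m. c * dist (u n) (u (n + m))) \<longlonglongrightarrow> c * dist (u n) xbar"
        by (intro tendsto_intros)
    qed
    then show ?thesis using lim S_iff by blast
  qed
  have "\<exists>xbar \<in> S x\<^sub>0. S xbar = {xbar}"
    by (rule exists_terminal_point) (use refl trans bounded limit in blast)+
  then obtain xbar where xbar: "xbar \<in> S x\<^sub>0" "S xbar = {xbar}"
    by blast
  show ?thesis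
  proof (intro exI[of _ xbar] conjI allI impI)
    show "f x\<^sub>0 \<subseteq> f xbar + {(\<epsilon> / lam * dist x\<^sub>0 xbar) *\<^sub>R k\<^sub>0} + K"
      using xbar(1) by (simp add: S)
    show "\<not> f xbar \<subseteq> f x + {(\<epsilon> / lam * dist xbar x) *\<^sub>R k\<^sub>0} + K" if "x \<noteq> xbar" for x
      using xbar(2) that S[of xbar] by auto
    show "dist x\<^sub>0 xbar \<le> lam" using near[OF xbar(1)] by simp
  qed
qed

end
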